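(* Let $q\in\mathbb{C}\setminus\{0,1\}$ and let $(\mathcal{W}^q,[\cdot,\cdot]_\sigma,\alpha)$ be the $q$-deformed Witt superalgebra. If $\varphi$ is an odd $q$-derivation of degree $s\in\mathbb{Z}$ of $\mathcal{W}^q$, then $\varphi$ is an inner $q$-derivation; more precisely, $$(\mathrm{Der}\,\mathcal{W}^q)_1=\bigoplus_{s\in\mathbb{Z}}\langle \mathrm{ad}_{G_s}\rangle .$$
   Context: For $n\in\mathbb{Z}$ put $\{n\}=\frac{1-q^n}{1-q}$. $\mathcal{W}^q$ is the complex superspace with basis $\{L_n\}_{n\in\mathbb{Z}}$ (parity $0$) and $\{G_n\}_{n\in\mathbb{Z}}$ (parity $1$), with the bilinear bracket $$[L_n,L_m]_\sigma=(\{m\}-\{n\})L_{n+m},\quad [L_n,G_m]_\sigma=(\{m+1\}-\{n\})G_{n+m},\quad [G_m,L_n]_\sigma=-[L_n,G_m]_\sigma,\quad [G_n,G_m]_\sigma=0,$$ and the even linear map $\alpha(L_n)=(1+q^n)L_n$, $\alpha(G_n)=(1+q^{n+1})G_n$. Let $\mathcal{W}^q_n=\mathrm{span}_{\mathbb{C}}\{L_n,G_n\}$, so $\mathcal{W}^q=\bigoplus_{n\in\mathbb{Z}}\mathcal{W}^q_n$. An odd $q$-derivation of degree $s$ is a linear map $\varphi:\mathcal{W}^q\to\mathcal{W}^q$ that exchanges parities, satisfies $\varphi(\mathcal{W}^q_n)\subset\mathcal{W}^q_{n+s}$ for all $n$, and satisfies $$\varphi([x,y]_\sigma)=\frac{1}{1+q^{s+1}}\big([\varphi(x),\alpha(y)]_\sigma+(-1)^{|x|}[\alpha(x),\varphi(y)]_\sigma\big)$$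 for all homogeneous $x,y$, where $|x|$ is the parity of $x$. For a homogeneous $a\in\mathcal{W}^q$, $\mathrm{ad}_a(x)=[a,x]_\sigma$; the maps $\mathrm{ad}_a$ are called inner $q$-derivations. $(\mathrm{Der}\,\mathcal{W}^q)_1$ denotes the direct sum over $s\in\mathbb{Z}$ of the spaces of odd $q$-derivations of degree $s$, and $\langle\cdot\rangle$ denotes linear span.
   Formalization: Excludes q=-1, where L_0↦G_{-1} (all other basis vectors ↦0) is a non-inner odd q-derivation of degree -1; assumes 1+q^{s+1}≠0 in the first claim, and for all s in the direct sum formula, since the fraction 1/(1+q^{s+1}) is otherwise undefined. *)

theory Defs
  imports Complex_Main "HOL-Library.Poly_Mapping" "HOL-Library.Function_Algebras"
begin

text \<open>The complex vector space with basis \<open>L\<^sub>n\<close>, \<open>G\<^sub>n\<close> (\<open>n \<in> \<int>\<close>) is the space of finitely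
  supported functions on the index type below.\<close>

datatype witt_index = L int | G int

type_synonym witt = "witt_index \<Rightarrow>\<^sub>0 complex"

definition smul :: "complex \<Rightarrow> witt \<Rightarrow> witt"
  where "smul c x = Poly_Mapping.map ((*) c) x"

definition bL :: "int \<Rightarrow> witt" where "bL n = Poly_Mapping.single (L n) 1"

definition bG :: "int \<Rightarrow> witt" where "bG n = Poly_Mapping.single (G n) 1"

lemma lookup_smul [simp]: "Poly_Mapping.lookup (smul c x) i = c * Poly_Mapping.lookup x i"
  by (simp add: smul_def map.rep_eq when_def)

global_interpretation W: vector_space smul
  by unfold_locales (auto intro!: poly_mapping_eqI simp: lookup_add algebra_simps)

text \<open>Maps \<open>witt \<Rightarrow> witt\<close> are added and scaled pointwise.\<close>

definition fsmul :: "complex \<Rightarrow> (witt \<Rightarrow> witt) \<Rightarrow> witt \<Rightarrow> witt"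
  where "fsmul c \<phi> = (\<lambda>x. smul c (\<phi> x))"

global_interpretation E: vector_space fsmul
  by unfold_locales
    (auto simp: fsmul_def W.scale_right_distrib W.scale_left_distrib)

definition qnum :: "complex \<Rightarrow> int \<Rightarrow> complex"
  where "qnum q n = (1 - q powi n) / (1 - q)"

fun basis_bracket :: "complex \<Rightarrow> witt_index \<Rightarrow> witt_index \<Rightarrow> witt" where
  "basis_bracket q (L n) (L m) = smul (qnum q m - qnum q n) (bL (n + m))"
| "basis_bracket q (L n) (G m) = smul (qnum q (m + 1) - qnum q n) (bG (n + m))"
| "basis_bracket q (G m) (L n) = - smul (qnum q (m + 1) - qnum q n) (bG (n + m))"
| "basis_bracket q (G n) (G m) = 0"

definition bracket :: "complex \<Rightarrow> witt \<Rightarrow> witt \<Rightarrow> witt"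
  where "bracket q x y = (\<Sum>i\<in>Poly_Mapping.keys x. \<Sum>j\<in>Poly_Mapping.keys y.
    smul (Poly_Mapping.lookup x i * Poly_Mapping.lookup y j) (basis_bracket q i j))"

fun alpha_eigenvalue :: "complex \<Rightarrow> witt_index \<Rightarrow> complex" where
  "alpha_eigenvalue q (L n) = 1 + q powi n"
| "alpha_eigenvalue q (G n) = 1 + q powi (n + 1)"

definition alpha :: "complex \<Rightarrow> witt \<Rightarrow> witt"
  where "alpha q x = (\<Sum>i\<in>Poly_Mapping.keys x.
    smul (alpha_eigenvalue q i * Poly_Mapping.lookup x i) (Poly_Mapping.single i 1))"

definition witt_even :: "witt set" where "witt_even = W.span (range bL)"

definition witt_odd :: "witt set" where "witt_odd = W.span (range bG)"

definition witt_deg :: "int \<Rightarrow> witt set" where "witt_deg n = W.span {bL n, bG n}"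

definition parity_part :: "nat \<Rightarrow> witt set"
  where "parity_part p = (if p = 0 then witt_even else witt_odd)"

text \<open>The fraction below has its intended meaning only if \<open>1 + q\<^sup>s\<^sup>+\<^sup>1 \<noteq> 0\<close>; otherwise
  HOL's \<open>1 / 0 = 0\<close> applies, so theorems about degree \<open>s\<close> must assume this. In addition
  \<open>q = -1\<close> is degenerate: there the map \<open>L\<^sub>0 \<mapsto> G\<^sub>-\<^sub>1\<close>, all other basis vectors \<open>\<mapsto> 0\<close>, is an
  odd \<open>q\<close>-derivation of degree \<open>-1\<close> (with fraction \<open>1/2\<close>) that is not inner.\<close>

definition odd_q_derivation :: "complex \<Rightarrow> int \<Rightarrow> (witt \<Rightarrow> witt) \<Rightarrow> bool" where
  "odd_q_derivation q s \<phi> \<longleftrightarrow>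
     Vector_Spaces.linear smul smul \<phi> \<and>
     \<phi> ` witt_even \<subseteq> witt_odd \<and> \<phi> ` witt_odd \<subseteq> witt_even \<and>
     (\<forall>n. \<phi> ` witt_deg n \<subseteq> witt_deg (n + s)) \<and>
     (\<forall>p\<in>{0, 1}. \<forall>r\<in>{0, 1}. \<forall>x\<in>parity_part p. \<forall>y\<in>parity_part r.
        \<phi> (bracket q x y) =
          smul (1 / (1 + q powi (s + 1)))
            (bracket q (\<phi> x) (alpha q y) + smul ((-1) ^ p) (bracket q (alpha q x) (\<phi> y))))"

definition ad :: "complex \<Rightarrow> witt \<Rightarrow> witt \<Rightarrow> witt"
  where "ad q a = (\<lambda>x. bracket q a x)"

definition inner_q_derivation :: "complex \<Rightarrow> (witt \<Rightarrow> witt) \<Rightarrow> bool"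
  where "inner_q_derivation q \<phi> \<longleftrightarrow> (\<exists>a \<in> witt_even \<union> witt_odd. \<phi> = ad q a)"

definition subspace_sum :: "(int \<Rightarrow> (witt \<Rightarrow> witt) set) \<Rightarrow> (witt \<Rightarrow> witt) set"
  where "subspace_sum V = {(\<Sum>s\<in>S. f s) | S f. finite S \<and> (\<forall>s\<in>S. f s \<in> V s)}"

definition is_direct_sum :: "(witt \<Rightarrow> witt) set \<Rightarrow> (int \<Rightarrow> (witt \<Rightarrow> witt) set) \<Rightarrow> bool" where
  "is_direct_sum D V \<longleftrightarrow>
     (\<forall>s. E.subspace (V s)) \<and> D = subspace_sum V \<and>
     (\<forall>S f. finite S \<longrightarrow> (\<forall>s\<in>S. f s \<in> V s) \<longrightarrow> (\<Sum>s\<in>S. f s) = 0 \<longrightarrow> (\<forall>s\<in>S. f s = 0))"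

definition odd_q_derivations :: "complex \<Rightarrow> int \<Rightarrow> (witt \<Rightarrow> witt) set"
  where "odd_q_derivations q s = {\<phi>. odd_q_derivation q s \<phi>}"

definition Der_odd :: "complex \<Rightarrow> (witt \<Rightarrow> witt) set"
  where "Der_odd q = subspace_sum (odd_q_derivations q)"

lemma keys_bL [simp]: "Poly_Mapping.keys (bL n) = {L n}"
  and keys_bG [simp]: "Poly_Mapping.keys (bG n) = {G n}"
  and lookup_bL [simp]: "Poly_Mapping.lookup (bL n) (L n) = 1"
  and lookup_bG [simp]: "Poly_Mapping.lookup (bG n) (G n) = 1"
  by (simp_all add: bL_def bG_def)

lemma bracket_bL_bL: "bracket q (bL n) (bL m) = smul (qnum q m - qnum q n) (bL (n + m))"
  and bracket_bL_bG: "bracket q (bL n) (bG m) = smul (qnum q (m + 1) - qnum q n) (bG (n + m))"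
  and bracket_bG_bL: "bracket q (bG m) (bL n) = - bracket q (bL n) (bG m)"
  and bracket_bG_bG: "bracket q (bG n) (bG m) = 0"
  by (simp_all add: bracket_def)

lemma alpha_bL: "alpha q (bL n) = smul (1 + q powi n) (bL n)"
  and alpha_bG: "alpha q (bG n) = smul (1 + q powi (n + 1)) (bG n)"
  by (simp_all add: alpha_def) (simp_all add: bL_def bG_def)

lemma alpha_superset:
  assumes "finite A" "Poly_Mapping.keys x \<subseteq> A"
  shows "alpha q x = (\<Sum>i\<in>A.
    smul (alpha_eigenvalue q i * Poly_Mapping.lookup x i) (Poly_Mapping.single i 1))"
  unfolding alpha_def
  by (rule sum.mono_neutral_left) (use assms in \<open>auto simp: in_keys_iff\<close>)

lemma bracket_superset:
  assumes "finite A" "Poly_Mapping.keys x \<subseteq> A" "finite B" "Poly_Mapping.keys y \<subseteq> B"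
  shows "bracket q x y = (\<Sum>i\<in>A. \<Sum>j\<in>B.
    smul (Poly_Mapping.lookup x i * Poly_Mapping.lookup y j) (basis_bracket q i j))"
proof -
  have "bracket q x y = (\<Sum>i\<in>Poly_Mapping.keys x. \<Sum>j\<in>B.
    smul (Poly_Mapping.lookup x i * Poly_Mapping.lookup y j) (basis_bracket q i j))"
    unfolding bracket_def
    by (intro sum.cong refl sum.mono_neutral_left) (use assms in \<open>auto simp: in_keys_iff\<close>)
  also have "\<dots> = (\<Sum>i\<in>A. \<Sum>j\<in>B.
    smul (Poly_Mapping.lookup x i * Poly_Mapping.lookup y j) (basis_bracket q i j))"
    by (rule sum.mono_neutral_left) (use assms in \<open>auto simp: in_keys_iff\<close>)
  finally show ?thesis .
qed

lemma alpha_linear: "Vector_Spaces.linear smul smul (alpha q)"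
proof (unfold_locales)
  fix x y :: witt and c
  let ?A = "Poly_Mapping.keys x \<union> Poly_Mapping.keys y"
  have A: "finite ?A" "Poly_Mapping.keys (x + y) \<subseteq> ?A"
    by (simp, rule Poly_Mapping.keys_add)
  show "alpha q (x + y) = alpha q x + alpha q y"
    by (subst (1 2 3) alpha_superset[of ?A])
      (use A in \<open>auto simp: lookup_add distrib_left W.scale_left_distrib sum.distrib\<close>)
  have "Poly_Mapping.keys (smul c x) \<subseteq> Poly_Mapping.keys x"
    by (auto simp: in_keys_iff)
  then show "alpha q (smul c x) = smul c (alpha q x)"
    by (subst (1 2) alpha_superset[of "Poly_Mapping.keys x"])
      (auto simp: W.scale_sum_right mult_ac)
qed

lemma bracket_linear_left: "Vector_Spaces.linear smul smul (\<lambda>x. bracket q x y)"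
proof (unfold_locales)
  fix x x' :: witt and c
  let ?A = "Poly_Mapping.keys x \<union> Poly_Mapping.keys x'"
  have A: "finite ?A" "Poly_Mapping.keys (x + x') \<subseteq> ?A"
    by (simp, rule Poly_Mapping.keys_add)
  show "bracket q (x + x') y = bracket q x y + bracket q x' y"
    by (subst (1 2 3) bracket_superset[of ?A _ "Poly_Mapping.keys y"])
      (use A in \<open>auto simp: lookup_add distrib_right W.scale_left_distrib sum.distrib\<close>)
  have "Poly_Mapping.keys (smul c x) \<subseteq> Poly_Mapping.keys x"
    by (auto simp: in_keys_iff)
  then show "bracket q (smul c x) y = smul c (bracket q x y)"
    by (subst (1 2) bracket_superset[of "Poly_Mapping.keys x" _ "Poly_Mapping.keys y"])
      (auto simp: W.scale_sum_right mult_ac)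
qed

lemma bracket_linear_right: "Vector_Spaces.linear smul smul (bracket q x)"
proof (unfold_locales)
  fix y y' :: witt and c
  let ?A = "Poly_Mapping.keys y \<union> Poly_Mapping.keys y'"
  have A: "finite ?A" "Poly_Mapping.keys (y + y') \<subseteq> ?A"
    by (simp, rule Poly_Mapping.keys_add)
  show "bracket q x (y + y') = bracket q x y + bracket q x y'"
    by (subst (1 2 3) bracket_superset[of "Poly_Mapping.keys x" _ ?A])
      (use A in \<open>auto simp: lookup_add distrib_left W.scale_left_distrib sum.distrib\<close>)
  have "Poly_Mapping.keys (smul c y) \<subseteq> Poly_Mapping.keys y"
    by (auto simp: in_keys_iff)
  then show "bracket q x (smul c y) = smul c (bracket q x y)"
    by (subst (1 2) bracket_superset[of "Poly_Mapping.keys x" _ "Poly_Mapping.keys y"])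
      (auto simp: W.scale_sum_right mult_ac)
qed

text \<open>The sum defining \<^const>\<open>Der_odd\<close> is direct.\<close>

lemma E_subspace_odd_q_derivations: "E.subspace (odd_q_derivations q s)"
proof (rule E.subspaceI)
  note br = vector_space_pair.linear_0[OF _ bracket_linear_left]
    vector_space_pair.linear_0[OF _ bracket_linear_right]
    vector_space_pair.linear_add[OF _ bracket_linear_left]
    vector_space_pair.linear_add[OF _ bracket_linear_right]
    vector_space_pair.linear_scale[OF _ bracket_linear_left]
    vector_space_pair.linear_scale[OF _ bracket_linear_right]
  have VP: "vector_space_pair smul smul" by unfold_locales
  note br = br[OF VP]
  note spans = witt_even_def witt_odd_def witt_deg_def
  show "0 \<in> odd_q_derivations q s"
    by (auto simp: odd_q_derivations_def odd_q_derivation_def br spans W.span_zero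
        vector_space_pair.linear_zero[OF VP] zero_fun_def image_subset_iff)
  fix \<phi> \<psi> :: "witt \<Rightarrow> witt" and c :: complex
  assume 1: "\<phi> \<in> odd_q_derivations q s"
  show "fsmul c \<phi> \<in> odd_q_derivations q s"
    using 1 by (auto simp: odd_q_derivations_def odd_q_derivation_def fsmul_def br spans
        image_subset_iff W.scale_right_distrib W.scale_right_diff_distrib mult_ac
        intro!: vector_space_pair.linear_compose_scale_right[OF VP] W.span_scale)
  assume 2: "\<psi> \<in> odd_q_derivations q s"
  show "\<phi> + \<psi> \<in> odd_q_derivations q s"
    using 1 2 by (auto simp: odd_q_derivations_def odd_q_derivation_def plus_fun_def br spans
        image_subset_iff W.scale_right_distrib W.scale_right_diff_distrib
        add_diff_add add_ac
        intro!: vector_space_pair.linear_compose_add[OF VP] W.span_add)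
qed

fun index_deg :: "witt_index \<Rightarrow> int" where
  "index_deg (L n) = n"
| "index_deg (G n) = n"

lemma single_in_witt_deg: "Poly_Mapping.single i 1 \<in> witt_deg (index_deg i)"
  by (cases i) (auto simp: witt_deg_def bL_def bG_def intro!: W.span_base)

lemma lookup_witt_deg:
  assumes "x \<in> witt_deg n" "index_deg k \<noteq> n"
  shows "Poly_Mapping.lookup x k = 0"
  using assms(1) unfolding witt_deg_def
proof (induction rule: W.span_induct)
  case base
  show ?case by (auto simp: W.subspace_def lookup_add)
next
  case (step x)
  then show ?case using assms(2)
    by (cases k) (auto simp: bL_def bG_def lookup_single when_def)
qed

lemma witt_expand:
  "x = (\<Sum>i\<in>Poly_Mapping.keys x. smul (Poly_Mapping.lookup x i) (Poly_Mapping.single i 1))"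
  by (rule poly_mapping_eqI)
    (auto simp: lookup_sum lookup_single when_def if_distrib[of "(*) _"] in_keys_iff cong: if_cong)

lemma Der_odd_direct_sum: "is_direct_sum (Der_odd q) (odd_q_derivations q)"
  unfolding is_direct_sum_def
proof (intro conjI allI impI ballI E_subspace_odd_q_derivations)
  show "Der_odd q = subspace_sum (odd_q_derivations q)" by (simp add: Der_odd_def)
  fix S s and f :: "int \<Rightarrow> witt \<Rightarrow> witt"
  assume fin: "finite S" and mem: "\<forall>s\<in>S. f s \<in> odd_q_derivations q s"
    and sum0: "(\<Sum>s\<in>S. f s) = 0" and s: "s \<in> S"
  have app: "(\<Sum>t\<in>T. f t) x = (\<Sum>t\<in>T. f t x)" for T x
    by (induction T rule: infinite_finite_induct) auto
  have basis0: "f s (Poly_Mapping.single i 1) = 0" for i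
  proof (rule poly_mapping_eqI)
    fix k
    let ?b = "Poly_Mapping.single i 1 :: witt"
    have deg: "f t ?b \<in> witt_deg (index_deg i + t)" if "t \<in> S" for t
      using mem that single_in_witt_deg[of i]
      by (auto simp: odd_q_derivations_def odd_q_derivation_def image_subset_iff)
    show "Poly_Mapping.lookup (f s ?b) k = Poly_Mapping.lookup 0 k"
    proof (cases "index_deg k = index_deg i + s")
      case False
      then show ?thesis using lookup_witt_deg[OF deg[OF s]] by simp
    next
      case True
      have "0 = Poly_Mapping.lookup ((\<Sum>t\<in>S. f t) ?b) k" by (simp add: sum0)
      also have "\<dots> = (\<Sum>t\<in>S. Poly_Mapping.lookup (f t ?b) k)"
        by (simp add: app lookup_sum)
      also have "\<dots> = (\<Sum>t\<in>{s}. Poly_Mapping.lookup (f t ?b) k)"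
        using fin s True lookup_witt_deg[OF deg] by (intro sum.mono_neutral_right) auto
      finally show ?thesis by simp
    qed
  qed
  have lin: "Vector_Spaces.linear smul smul (f s)"
    using mem s by (auto simp: odd_q_derivations_def odd_q_derivation_def)
  have VP: "vector_space_pair smul smul" by unfold_locales
  show "f s = 0"
  proof
    fix x
    show "f s x = 0 x"
      by (subst witt_expand[of x])
        (simp add: vector_space_pair.linear_sum[OF VP lin]
          vector_space_pair.linear_scale[OF VP lin] basis0)
  qed
qed

end

theory Submission
  imports Defs
begin

text \<open>Write \<open>\<phi>(L\<^sub>n) = a\<^sub>n G\<^sub>n\<^sub>+\<^sub>s\<close>, \<open>\<phi>(G\<^sub>n) = b\<^sub>n L\<^sub>n\<^sub>+\<^sub>s\<close> and \<open>t = q\<^sup>s\<^sup>+\<^sup>1\<close>. The derivation rule on \<open>(G\<^sub>n, G\<^sub>n)\<close>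
  and \<open>(L\<^sub>0, G\<^sub>n)\<close> kills almost every \<open>b\<^sub>n\<close>, and the rule on \<open>(L\<^sub>1, G\<^sub>n)\<close> the remaining ones.
  The rule on \<open>(L\<^sub>n, L\<^sub>m)\<close> is linear in \<open>a\<close> and is solved by \<open>q\<^sup>n - t\<close>, which comes from \<open>ad\<close> of \<open>G\<^sub>s\<close>.
  Subtracting a multiple of this solution one may assume \<open>a\<^sub>0 = 0\<close> (if \<open>t \<noteq> 1\<close>) or \<open>a\<^sub>1 = 0\<close>
  (if \<open>t = 1\<close>), and then \<open>a = 0\<close>.\<close>

section \<open>Linear maps on \<open>witt\<close> and homogeneous vectors\<close>

interpretation VP: vector_space_pair smul smul by unfold_locales

lemmas bracket_linear_simps =
  VP.linear_0[OF bracket_linear_left] VP.linear_0[OF bracket_linear_right]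
  VP.linear_scale[OF bracket_linear_left] VP.linear_scale[OF bracket_linear_right]

lemma linear_eqI:
  assumes "Vector_Spaces.linear smul smul f" "Vector_Spaces.linear smul smul g"
    and "\<And>n. f (bL n) = g (bL n)" "\<And>n. f (bG n) = g (bG n)"
  shows "f = g"
proof
  fix x
  have single: "f (Poly_Mapping.single i 1) = g (Poly_Mapping.single i 1)" for i
    using assms(3,4) by (cases i) (simp_all add: bL_def bG_def)
  show "f x = g x"
    by (subst (1 2) witt_expand[of x])
      (simp add: VP.linear_sum[OF assms(1)] VP.linear_sum[OF assms(2)]
        VP.linear_scale[OF assms(1)] VP.linear_scale[OF assms(2)] single)
qed

lemma lookup_witt_odd_L: "x \<in> witt_odd \<Longrightarrow> Poly_Mapping.lookup x (L k) = 0"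
  unfolding witt_odd_def
  by (induction rule: W.span_induct) (auto simp: W.subspace_def lookup_add bG_def lookup_single)

lemma lookup_witt_even_G: "x \<in> witt_even \<Longrightarrow> Poly_Mapping.lookup x (G k) = 0"
  unfolding witt_even_def
  by (induction rule: W.span_induct) (auto simp: W.subspace_def lookup_add bL_def lookup_single)

text \<open>Parity and degree together leave one index in the support. With
  \<open>witt_even_deg\<close>, this reduces an odd homogeneous map to two scalar sequences.\<close>

lemma witt_odd_deg:
  assumes "x \<in> witt_odd" "x \<in> witt_deg n"
  shows "x = smul (Poly_Mapping.lookup x (G n)) (bG n)"
proof (rule poly_mapping_eqI)
  fix k
  show "Poly_Mapping.lookup x k = Poly_Mapping.lookup (smul (Poly_Mapping.lookup x (G n)) (bG n)) k"
    using lookup_witt_odd_L[OF assms(1)] lookup_witt_deg[OF assms(2), of k]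
    by (cases k) (auto simp: bG_def lookup_single when_def)
qed

lemma witt_even_deg:
  assumes "x \<in> witt_even" "x \<in> witt_deg n"
  shows "x = smul (Poly_Mapping.lookup x (L n)) (bL n)"
proof (rule poly_mapping_eqI)
  fix k
  show "Poly_Mapping.lookup x k = Poly_Mapping.lookup (smul (Poly_Mapping.lookup x (L n)) (bL n)) k"
    using lookup_witt_even_G[OF assms(1)] lookup_witt_deg[OF assms(2), of k]
    by (cases k) (auto simp: bL_def lookup_single when_def)
qed

lemma bL_even: "bL n \<in> witt_even" and bG_odd: "bG n \<in> witt_odd"
  and bL_deg: "bL n \<in> witt_deg n" and bG_deg: "bG n \<in> witt_deg n"
  by (auto simp: witt_even_def witt_odd_def witt_deg_def intro: W.span_base)

section \<open>Scalar recurrences for the coefficients\<close>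

lemma qnum_diff: "qnum q m - qnum q n = (q powi n - q powi m) / (1 - q)"
  by (simp add: qnum_def diff_divide_distrib)

lemma smul_bL_eq: "smul c (bL n) = smul d (bL n) \<longleftrightarrow> c = d"
  and smul_bG_eq: "smul c (bG n) = smul d (bG n) \<longleftrightarrow> c = d"
  by (metis lookup_smul lookup_bL mult.right_neutral) (metis lookup_smul lookup_bG mult.right_neutral)

text \<open>The diagonal of \<open>GG\<close> carries the factors \<open>1 + q^(m+1)\<close> and
  \<open>t - q^2\<close>. Hence only \<open>q^(m+1) = -1\<close> or \<open>t = q^2\<close> can leave
  \<open>b m\<close> nonzero, and \<open>LG\<close> settles both.\<close>

lemma q_derivation_even_coeffs_zero:
  fixes q t :: complex and b :: "int \<Rightarrow> complex"
  assumes q: "q \<noteq> 0" "q \<noteq> 1" "q \<noteq> -1" and t: "t \<noteq> 0"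
    and LG: "\<And>n m. (1 + t) * (q powi n - q * q powi m) * b (n + m) * q
      = b m * (1 + q powi n) * (q * q powi n - t * q powi m)"
    and GG: "\<And>n m. b n * (1 + q * q powi m) * (t * q powi n - q\<^sup>2 * q powi m)
      + b m * (1 + q * q powi n) * (t * q powi m - q\<^sup>2 * q powi n) = 0"
  shows "b m = 0"
proof -
  have q2: "q\<^sup>2 \<noteq> 1" using q by (simp add: power2_eq_1_iff)
  have L0: "b m * (q * (t - 1 - q * q powi m - t * q * q powi m) + 2 * t * q powi m) = 0" for m
    using LG[of 0 m] by (simp add: algebra_simps)
  have pnz: "q powi m \<noteq> 0" for m using q by simp
  show ?thesis
  proof (cases "t = q\<^sup>2")
    case False
    have "2 * (b m * (1 + q * q powi m) * (t * q powi m - q\<^sup>2 * q powi m)) = 0"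
      using GG[of m m] by (simp only: mult_2)
    then have "b m * (1 + q * q powi m) * (q powi m * (t - q\<^sup>2)) = 0"
      by (simp add: right_diff_distrib mult.commute)
    then consider "b m = 0" | "q * q powi m = -1"
      using False pnz[of m] by (auto simp: add_eq_0_iff)
    then show ?thesis
    proof cases
      case 2
      \<comment> \<open>After multiplication by \<open>q\<close>, the power \<open>q powi m\<close>
        occurs only inside \<open>q * q powi m\<close>, which can be replaced by
        \<open>-1\<close>.\<close>
      have "q * (b m * (q * (t - 1 - q * q powi m - t * (q * q powi m)) + 2 * t * q powi m)) = 0"
        using L0[of m] by (simp add: algebra_simps)
      then have "b m * (q * (q * (t - 1 - q * q powi m - t * (q * q powi m))) + 2 * t * (q * q powi m)) = 0"
        by (simp add: algebra_simps)
      then have "2 * t * b m * (q\<^sup>2 - 1) = 0"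
        unfolding 2 by (simp add: algebra_simps power2_eq_square)
      then show ?thesis using t q2 by simp
    qed
  next
    case True
    have bz: "b m = 0" if "q * q powi m \<noteq> 1" for m
    \<comment> \<open>For \<open>t = q^2\<close> the factor of \<open>b m\<close> in
      \<open>L0\<close> is \<open>q * (q^2 - 1) * (1 - q^(m+1))\<close>.\<close>
    proof -
      have "q * (b m * ((q\<^sup>2 - 1) * (1 - q * q powi m))) = 0"
        using L0[of m] unfolding True by (simp add: algebra_simps power2_eq_square)
      then show ?thesis using that q q2 by auto
    qed
    show ?thesis
    proof (cases "q * q powi m = 1")
      case 1: True
      \<comment> \<open>An exceptional index has an ordinary right neighbour, because
        \<open>q^(m+2) = q\<close>. \<open>LG\<close> with \<open>n = 1\<close> carries the
        vanishing back to \<open>m\<close>.\<close>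
      have "q * q powi (1 + m) \<noteq> 1"
        using 1 q by (simp add: power_int_add)
      then have "b (1 + m) = 0" by (rule bz)
      then have "b m * (1 + q) * (q * q - q * (q * q powi m)) = 0"
        using LG[of 1 m] by (simp add: True power2_eq_square algebra_simps)
      then have "b m * (1 + q) * (q * (q - 1)) = 0"
        unfolding 1 by (simp add: algebra_simps)
      then show ?thesis using q by (auto simp: add_eq_0_iff)
    qed (rule bz)
  qed
qed

text \<open>\<open>LL\<close> with \<open>n = 0\<close> reads
  \<open>a m * (t - 1) * (1 + q^m) = 0\<close>, so only indices with \<open>q^m = -1\<close> need
  their neighbours.\<close>

lemma q_derivation_odd_coeffs_zero_generic:
  fixes q t :: complex and a :: "int \<Rightarrow> complex"
  assumes q: "q \<noteq> 0" "q \<noteq> 1" "q \<noteq> -1" and t: "t \<noteq> 1"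
    and LL: "\<And>n m. (1 + t) * (q powi n - q powi m) * a (n + m)
      = a m * (1 + q powi n) * (q powi n - t * q powi m)
        - a n * (1 + q powi m) * (q powi m - t * q powi n)"
    and a0: "a 0 = 0"
  shows "a m = 0"
proof -
  have az: "a m = 0" if "q powi m \<noteq> -1" for m
  proof -
    have "a m * ((t - 1) * (1 + q powi m)) = 0"
      using LL[of 0 m] by (simp add: a0 algebra_simps)
    then show ?thesis using t that by (auto simp: add_eq_0_iff)
  qed
  show ?thesis
  proof (cases "q powi m = -1")
    case True
    have "q powi (1 + m) \<noteq> -1" "q powi (-1 + m) \<noteq> -1"
      using True q unfolding power_int_add[OF disjI1[OF q(1)]]
      by (auto simp: power_int_minus)
    then have "a (1 + m) = 0" "a (-1 + m) = 0"
      by (simp_all add: az)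
    \<comment> \<open>The terms with \<open>a 1\<close> and \<open>a (-1)\<close> drop out because
      \<open>1 + q^m = 0\<close>. Since \<open>q\<close> differs from its inverse,
      \<open>q + t\<close> and \<open>inverse q + t\<close> cannot both vanish.\<close>
    then have "a m * (1 + q) * (q + t) = 0" "a m * (1 + inverse q) * (inverse q + t) = 0"
      using LL[of 1 m] LL[of "-1" m] True by (simp_all add: power_int_minus)
    moreover have "1 + q \<noteq> 0" "1 + inverse q \<noteq> 0"
      using q by (auto simp: add_eq_0_iff) (metis inverse_minus_eq inverse_1 inverse_inverse_eq)
    moreover have "q \<noteq> inverse q"
      using q by (metis right_inverse power2_eq_square power2_eq_1_iff)
    ultimately show ?thesis by (metis add_right_cancel mult_eq_0_iff)
  qed (rule az)
qed

lemma q_derivation_odd_coeffs_zero_one: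
  fixes q :: complex and a :: "int \<Rightarrow> complex"
  assumes q: "q \<noteq> 0" "q \<noteq> 1" "q \<noteq> -1"
    and LL: "\<And>n m. 2 * (q powi n - q powi m) * a (n + m)
      = a m * (1 + q powi n) * (q powi n - q powi m)
        - a n * (1 + q powi m) * (q powi m - q powi n)"
    and a1: "a 1 = 0"
  shows "a m = 0"
proof -
  have R: "2 * a (n + m) = a n * (1 + q powi m) + a m * (1 + q powi n)"
    if "q powi n \<noteq> q powi m" for n m
  proof -
    have "(q powi n - q powi m) * (2 * a (n + m) - (a n * (1 + q powi m) + a m * (1 + q powi n))) = 0"
      using LL[of n m] by (simp add: algebra_simps)
    then show ?thesis using that by simp
  qed
  have q1: "1 + q \<noteq> 0" using q by (auto simp: add_eq_0_iff)
  have qi: "q \<noteq> inverse q"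
    using q by (metis right_inverse power2_eq_square power2_eq_1_iff)
  have a0: "a 0 = 0" using R[of 0 1] q q1 a1 by simp
  have am1: "a (-1) = 0"
    using R[of 1 "-1"] qi q1 a0 a1 by (simp add: power_int_minus)
  have up: "2 * a (m + 1) = a m * (1 + q)" if "q powi m \<noteq> q" for m
    using R[of m 1] that a1 by simp
  have down: "2 * a (m - 1) = a m * (1 + inverse q)" if "q powi m \<noteq> inverse q" for m
    using R[of m "-1"] that am1 by (simp add: power_int_minus)
  have four: "(1 + q) * (1 + inverse q) \<noteq> 4"
  proof
    assume "(1 + q) * (1 + inverse q) = 4"
    then have "(q - 1)\<^sup>2 = 0"
      using q by (simp add: field_simps power2_eq_square)
    then show False using q by simp
  qed
  have Z: "x = 0" if "2 * y = x * (1 + q)" "2 * x = y * (1 + inverse q)" for x y :: complex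
  proof -
    have "x * ((1 + q) * (1 + inverse q)) = (x * (1 + q)) * (1 + inverse q)" by simp
    also have "\<dots> = 2 * (y * (1 + inverse q))" using that(1) by simp
    also have "\<dots> = x * 4" using that(2) by simp
    finally have "x * ((1 + q) * (1 + inverse q) - 4) = 0" by (simp add: algebra_simps)
    then show ?thesis using four by simp
  qed
  \<comment> \<open>The round trip through \<open>m + 1\<close>, and in \<open>z2\<close> the one
    through \<open>m - 1\<close>, exclude different powers of \<open>q\<close>.\<close>
  have z1: "a m = 0" if "q powi m \<noteq> q" "q powi (m + 1) \<noteq> inverse q" for m
    using Z[OF up[OF that(1)]] down[OF that(2)] by simp
  have z2: "a m = 0" if "q powi m \<noteq> inverse q" "q powi (m - 1) \<noteq> q" for m
  proof -
    have "a (m - 1) = 0"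
      using Z[of "a m" "a (m - 1)"] up[OF that(2)] down[OF that(1)] by simp
    then show ?thesis using up[OF that(2)] by simp
  qed
  have s: "q powi (m + 1) = q powi m * q" "q powi (m - 1) * q = q powi m" for m
    using q by (simp_all add: power_int_add power_int_diff)
  show ?thesis
  proof (rule ccontr)
    assume nz: "a m \<noteq> 0"
    have A: "q powi m = q \<or> q powi m * q * q = 1"
      using z1[of m] nz q s(1)[of m] by (auto simp: field_simps)
    have B: "q powi m * q = 1 \<or> q powi m = q * q"
      using z2[of m] nz q s(2)[of m, symmetric] by (auto simp: eq_divide_eq inverse_eq_divide)
    \<comment> \<open>With \<open>q^m = q\<close>, either alternative of \<open>B\<close> would
      force \<open>q^2 = 1\<close> or \<open>q = 1\<close>.\<close>
    have nq: "q powi m \<noteq> q"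
      using B q by (auto simp: square_eq_1_iff)
    then have C: "q powi m * q * q = 1" "q powi m = q * q"
      using A B q by auto
    \<comment> \<open>Only \<open>q\<^sup>4 = 1\<close> is left; here the neighbour \<open>m + 1\<close> is covered by \<open>z1\<close>.\<close>
    have "a (m + 1) = 0"
    proof (rule z1)
      show "q powi (m + 1) \<noteq> q"
        using C q s(1)[of m] by (auto simp: square_eq_1_iff)
      show "q powi (m + 1 + 1) \<noteq> inverse q"
        using C q s(1)[of m] s(1)[of "m + 1"] by auto
    qed
    then show False using up[OF nq] nz q1 by simp
  qed
qed

lemma q_derivation_odd_coeffs:
  fixes q t :: complex and a :: "int \<Rightarrow> complex"
  assumes q: "q \<noteq> 0" "q \<noteq> 1" "q \<noteq> -1"
    and LL: "\<And>n m. (1 + t) * (q powi n - q powi m) * a (n + m)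
      = a m * (1 + q powi n) * (q powi n - t * q powi m)
        - a n * (1 + q powi m) * (q powi m - t * q powi n)"
  shows "\<exists>k. \<forall>n. a n = k * (q powi n - t)"
proof -
  define d where "d k n = a n - k * (q powi n - t)" for k n
  \<comment> \<open>The sequence \<open>q powi n - t\<close> solves the same linear
    equations.\<close>
  have LL': "(1 + t) * (q powi n - q powi m) * d k (n + m)
      = d k m * (1 + q powi n) * (q powi n - t * q powi m)
        - d k n * (1 + q powi m) * (q powi m - t * q powi n)" for k n m
    using LL[of n m] q unfolding d_def by (simp add: power_int_add algebra_simps)
  show ?thesis
  proof (cases "t = 1")
    case True
    \<comment> \<open>The known solution vanishes at \<open>0\<close> when \<open>t = 1\<close>, but
      is \<open>q - 1\<close> at \<open>1\<close>; otherwise its value \<open>1 - t\<close> at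
      \<open>0\<close> is nonzero.\<close>
    have "d (a 1 / (q - 1)) n = 0" for n
      by (rule q_derivation_odd_coeffs_zero_one[OF q LL'[unfolded True mult_1_left one_add_one]])
        (use True q in \<open>simp add: d_def\<close>)
    then show ?thesis unfolding d_def right_minus_eq by blast
  next
    case False
    have "d (a 0 / (1 - t)) n = 0" for n
      by (rule q_derivation_odd_coeffs_zero_generic[OF q False LL'])
        (use False in \<open>simp add: d_def\<close>)
    then show ?thesis unfolding d_def right_minus_eq by blast
  qed
qed

section \<open>Odd derivations are inner\<close>

lemma odd_q_derivation_eq_ad:
  assumes q: "q \<noteq> 0" "q \<noteq> 1" "q \<noteq> -1"
    and s: "1 + q powi (s + 1) \<noteq> 0" and \<phi>: "odd_q_derivation q s \<phi>"
  shows "\<exists>k. \<phi> = ad q (smul k (bG s))"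
proof -
  define t where "t = q powi (s + 1)"
  have t: "t \<noteq> 0" "1 + t \<noteq> 0" using q s by (auto simp: t_def)
  have qs: "q powi s = t / q" using q by (simp add: t_def power_int_add)
  define a where "a n = Poly_Mapping.lookup (\<phi> (bL n)) (G (n + s))" for n
  define b where "b n = Poly_Mapping.lookup (\<phi> (bG n)) (L (n + s))" for n
  have lin: "Vector_Spaces.linear smul smul \<phi>"
    using \<phi> by (simp add: odd_q_derivation_def)
  have \<phi>sub: "\<phi> ` witt_even \<subseteq> witt_odd" "\<phi> ` witt_odd \<subseteq> witt_even"
      "\<phi> ` witt_deg n \<subseteq> witt_deg (n + s)" for n
    using \<phi> by (simp_all add: odd_q_derivation_def)
  have \<phi>L: "\<phi> (bL n) = smul (a n) (bG (n + s))" for n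
    unfolding a_def by (rule witt_odd_deg)
      (use \<phi>sub bL_even[of n] bL_deg[of n] in blast)+
  have \<phi>G: "\<phi> (bG n) = smul (b n) (bL (n + s))" for n
    unfolding b_def by (rule witt_even_deg)
      (use \<phi>sub bG_odd[of n] bG_deg[of n] in blast)+
  \<comment> \<open>Clearing the denominator relies on \<open>1 + t\<close> being nonzero; otherwise
    the fraction would be \<open>0\<close> by convention.\<close>
  have der: "smul (1 + t) (\<phi> (bracket q x y)) =
      bracket q (\<phi> x) (alpha q y) + smul ((-1) ^ p) (bracket q (alpha q x) (\<phi> y))"
    if "p \<in> {0, 1}" "r \<in> {0, 1}" "x \<in> parity_part p" "y \<in> parity_part r" for p r x y
  proof -
    have "\<phi> (bracket q x y) = smul (1 / (1 + t))
        (bracket q (\<phi> x) (alpha q y) + smul ((-1) ^ p) (bracket q (alpha q x) (\<phi> y)))"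
      unfolding t_def
      by (rule \<phi>[unfolded odd_q_derivation_def, THEN conjunct2, THEN conjunct2, THEN conjunct2,
            THEN conjunct2, rule_format, OF that])
    then show ?thesis using t by simp
  qed
  note simps = \<phi>L \<phi>G alpha_bL alpha_bG bracket_linear_simps VP.linear_scale[OF lin]
    VP.linear_0[OF lin] bracket_bL_bL bracket_bL_bG bracket_bG_bL bracket_bG_bG qnum_diff
  have LL: "(1 + t) * (q powi n - q powi m) * a (n + m)
      = a m * (1 + q powi n) * (q powi n - t * q powi m)
        - a n * (1 + q powi m) * (q powi m - t * q powi n)" for n m
  proof -
    have "smul ((1 + t) * ((q powi n - q powi m) / (1 - q)) * a (n + m)) (bG (n + m + s)) =
      smul (a m * (1 + q powi n) * ((q powi n - q powi (m + s + 1)) / (1 - q))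
        - a n * (1 + q powi m) * ((q powi m - q powi (n + s + 1)) / (1 - q))) (bG (n + m + s))"
      using der[of 0 0 "bL n" "bL m"] bL_even
      by (simp add: parity_part_def simps W.scale_left_diff_distrib mult_ac add_ac)
    then show ?thesis
      using q unfolding smul_bG_eq by (simp add: power_int_add qs divide_simps) (simp add: algebra_simps)
  qed
  \<comment> \<open>Only one term survives on the right, as \<phi> sends \<open>L\<close> to
    \<open>G\<close> and two \<open>G\<close> bracket to zero. The extra \<open>q\<close> clears
    \<open>q^s = t / q\<close>.\<close>
  have LG: "(1 + t) * (q powi n - q * q powi m) * b (n + m) * q
      = b m * (1 + q powi n) * (q * q powi n - t * q powi m)" for n m
  proof -
    have "smul ((1 + t) * ((q powi n - q powi (m + 1)) / (1 - q)) * b (n + m)) (bL (n + m + s)) =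
      smul (b m * (1 + q powi n) * ((q powi n - q powi (m + s)) / (1 - q))) (bL (n + m + s))"
      using der[of 0 1 "bL n" "bG m"] bL_even bG_odd
      by (simp add: parity_part_def simps mult_ac add_ac)
    then show ?thesis
      using q unfolding smul_bL_eq by (simp add: power_int_add qs divide_simps) (simp add: algebra_simps)
  qed
  \<comment> \<open>The sign of the odd rule cancels against antisymmetry of the bracket, so the
    expression is symmetric in \<open>n\<close> and \<open>m\<close> and its diagonal is
    informative.\<close>
  have GG: "b n * (1 + q * q powi m) * (t * q powi n - q\<^sup>2 * q powi m)
      + b m * (1 + q * q powi n) * (t * q powi m - q\<^sup>2 * q powi n) = 0" for n m
  proof -
    have "smul (b n * (1 + q powi (m + 1)) * ((q powi (n + s) - q powi (m + 1)) / (1 - q))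
      + b m * (1 + q powi (n + 1)) * ((q powi (m + s) - q powi (n + 1)) / (1 - q))) (bG (n + m + s))
      = bracket q (\<phi> (bG n)) (alpha q (bG m))
        + smul ((-1) ^ 1) (bracket q (alpha q (bG n)) (\<phi> (bG m)))"
      by (simp add: simps) (simp add: W.scale_left_distrib mult_ac add_ac)
    also have "\<dots> = smul (1 + t) (\<phi> (bracket q (bG n) (bG m)))"
      by (rule der[of 1 1, symmetric]) (simp_all add: parity_part_def bG_odd)
    also have "\<dots> = smul 0 (bG (n + m + s))"
      by (simp add: simps)
    finally show ?thesis
      using q unfolding smul_bG_eq by (simp add: power_int_add qs divide_simps)
        (simp add: algebra_simps power2_eq_square)
  qed
  have b0: "b n = 0" for n
    by (rule q_derivation_even_coeffs_zero[OF q t(1) LG GG])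
  obtain k where k: "\<And>n. a n = k * (q powi n - t)"
    using q_derivation_odd_coeffs[OF q LL] by auto
  \<comment> \<open>The coefficient of \<open>ad q (bG s)\<close> on \<open>bL n\<close> is
    \<open>-(q^n - t) / (1 - q)\<close>.\<close>
  define c where "c = - k * (1 - q)"
  have "\<phi> = ad q (smul c (bG s))"
    unfolding ad_def
  proof (rule linear_eqI[OF lin bracket_linear_right])
    show "\<phi> (bL n) = bracket q (smul c (bG s)) (bL n)" for n
      using q by (simp add: simps k add_ac flip: W.scale_minus_left) (simp add: c_def t_def add_ac)
    show "\<phi> (bG n) = bracket q (smul c (bG s)) (bG n)" for n
      by (simp add: simps b0)
  qed
  then show ?thesis by blast
qed

section \<open>The maps \<open>ad q (bG s)\<close> are odd derivations\<close>

lemma linear_span_image_subset: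
  assumes "Vector_Spaces.linear smul smul f" "f ` B \<subseteq> W.span C"
  shows "f ` W.span B \<subseteq> W.span C"
proof -
  have "f ` W.span B = W.span (f ` B)" by (simp add: VP.linear_span_image[OF assms(1)])
  then show ?thesis using assms(2) by (simp add: W.span_minimal)
qed

text \<open>Both sides of the rule are bilinear, so basis vectors suffice. Only two \<open>L\<close>
  give a nontrivial identity; in all other cases every term contains a bracket of two odd
  vectors.\<close>

lemma odd_q_derivation_ad:
  assumes q: "q \<noteq> 0" "q \<noteq> 1" and s: "1 + q powi (s + 1) \<noteq> 0"
  shows "odd_q_derivation q s (ad q (bG s))"
proof -
  define t where "t = q powi (s + 1)"
  have t: "1 + t \<noteq> 0" using s by (simp add: t_def)
  have qs: "q powi s = t / q" using q by (simp add: t_def power_int_add)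
  have adL: "bracket q (bG s) (bL n) = smul ((t - q powi n) / (1 - q)) (bG (n + s))" for n
    by (simp add: bracket_bG_bL bracket_bL_bG qnum_diff t_def add_ac flip: W.scale_minus_left)
      (simp add: diff_divide_distrib)
  note lin = bracket_linear_right[of q "bG s"]
  define B where "B p = (if p = 0 then range bL else range bG)" for p :: nat
  have part: "parity_part p = W.span (B p)" for p
    by (simp add: parity_part_def B_def witt_even_def witt_odd_def)
  note simps = alpha_bL alpha_bG bracket_linear_simps bracket_bL_bL bracket_bL_bG
    bracket_bG_bL bracket_bG_bG qnum_diff
  have basis: "bracket q (bG s) (bracket q x y) = smul (1 / (1 + t))
      (bracket q (bracket q (bG s) x) (alpha q y)
        + smul ((-1) ^ p) (bracket q (alpha q x) (bracket q (bG s) y)))"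
    if "p \<in> {0, 1}" "r \<in> {0, 1}" "x \<in> B p" "y \<in> B r" for p r x y
  proof -
    have LL: "bracket q (bG s) (bracket q (bL n) (bL m)) = smul (1 / (1 + t))
        (bracket q (bracket q (bG s) (bL n)) (alpha q (bL m))
          + bracket q (alpha q (bL n)) (bracket q (bG s) (bL m)))" for n m
    proof -
      \<comment> \<open>\<open>?c\<close> and \<open>?d\<close> are the coefficients of
        \<open>bG (n + m + s)\<close> on the two sides, before division by
        \<open>1 + t\<close>.\<close>
      let ?c = "(q powi n - q powi m) / (1 - q) * ((t - q powi (n + m)) / (1 - q))"
      let ?d = "(1 + q powi n) * ((t - q powi m) / (1 - q)) * ((q powi n - q powi (m + s + 1)) / (1 - q))
        - (1 + q powi m) * ((t - q powi n) / (1 - q)) * ((q powi m - q powi (n + s + 1)) / (1 - q))"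
      have "(1 + t) * ?c = ?d"
        using q by (simp add: power_int_add qs divide_simps) (simp add: algebra_simps)
      then have cd: "?c = 1 / (1 + t) * ?d"
        using t by (simp add: field_simps)
      have "bracket q (bG s) (bracket q (bL n) (bL m)) = smul ?c (bG (n + m + s))"
        by (simp add: bracket_bL_bL qnum_diff bracket_linear_simps adL)
      also have "\<dots> = smul (1 / (1 + t)) (smul ?d (bG (n + m + s)))"
        by (simp only: cd W.scale_scale)
      also have "smul ?d (bG (n + m + s)) = bracket q (bracket q (bG s) (bL n)) (alpha q (bL m))
          + bracket q (alpha q (bL n)) (bracket q (bG s) (bL m))"
        by (simp add: adL alpha_bL bracket_linear_simps) (simp add: simps W.scale_left_diff_distrib mult_ac add_ac)
      finally show ?thesis .
    qed
    have LG: "bracket q (bG s) (bracket q (bL n) (bG m)) = 0"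
      "bracket q (bracket q (bG s) (bL n)) (alpha q (bG m)) = 0"
      "bracket q (alpha q (bL n)) (bracket q (bG s) (bG m)) = 0"
      "bracket q (bG s) (bracket q (bG m) (bL n)) = 0"
      "bracket q (bracket q (bG s) (bG m)) (alpha q (bL n)) = 0"
      "bracket q (alpha q (bG m)) (bracket q (bG s) (bL n)) = 0" for n m
      by (simp_all only: adL) (simp_all add: simps VP.linear_neg[OF lin])
    have GG: "bracket q (bG s) (bracket q (bG n) (bG m)) = 0"
      "bracket q (bracket q (bG s) (bG n)) (alpha q (bG m)) = 0"
      "bracket q (alpha q (bG n)) (bracket q (bG s) (bG m)) = 0" for n m
      by (simp_all add: bracket_bG_bG bracket_linear_simps)
    \<comment> \<open>The sign matters only for two even arguments, so \<open>p = 0\<close> is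
      recorded there alone.\<close>
    from that consider n m where "p = 0" "x = bL n" "y = bL m"
      | n m where "x = bL n" "y = bG m" | n m where "x = bG m" "y = bL n"
      | n m where "x = bG n" "y = bG m"
      by (auto simp: B_def split: if_splits)
    then show ?thesis
    proof cases
      case 1
      then show ?thesis using LL by simp
    qed (simp_all only: LG GG W.scale_zero_right add_0_right)
  qed
  have lin_l: "Vector_Spaces.linear smul smul (\<lambda>x. smul c
      (bracket q (bracket q (bG s) x) (alpha q y)
        + smul d (bracket q (alpha q x) (bracket q (bG s) y))))" for c d y
    using VP.linear_compose_scale_right[OF VP.linear_compose_add[OF
      Vector_Spaces.linear_compose[OF lin bracket_linear_left[of q "alpha q y"]]
      VP.linear_compose_scale_right[OF
        Vector_Spaces.linear_compose[OF alpha_linear bracket_linear_left], of d]], of c]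
    by (simp add: o_def)
  have lin_r: "Vector_Spaces.linear smul smul (\<lambda>y. smul c
      (bracket q (bracket q (bG s) x) (alpha q y)
        + smul d (bracket q (alpha q x) (bracket q (bG s) y))))" for c d x
    using VP.linear_compose_scale_right[OF VP.linear_compose_add[OF
      Vector_Spaces.linear_compose[OF alpha_linear bracket_linear_right[of q "bracket q (bG s) x"]]
      VP.linear_compose_scale_right[OF
        Vector_Spaces.linear_compose[OF lin bracket_linear_right], of d]], of c]
    by (simp add: o_def)
  have lin_bl: "Vector_Spaces.linear smul smul (\<lambda>x. bracket q (bG s) (bracket q x y))" for y
    using Vector_Spaces.linear_compose[OF bracket_linear_left lin] by (simp add: o_def)
  have lin_br: "Vector_Spaces.linear smul smul (\<lambda>y. bracket q (bG s) (bracket q x y))" for x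
    using Vector_Spaces.linear_compose[OF bracket_linear_right lin] by (simp add: o_def)
  have "bracket q (bG s) (bracket q x y) = smul (1 / (1 + t))
      (bracket q (bracket q (bG s) x) (alpha q y)
        + smul ((-1) ^ p) (bracket q (alpha q x) (bracket q (bG s) y)))"
    if p: "p \<in> {0, 1}" and r: "r \<in> {0, 1}" and x: "x \<in> parity_part p" and y: "y \<in> parity_part r"
    for p r x y
    \<comment> \<open>The inner use extends the identity in \<open>y\<close> for a basis vector
      \<open>x\<close>, the outer one in \<open>x\<close>.\<close>
    using VP.linear_eq_on[OF lin_bl lin_l x[unfolded part]
        VP.linear_eq_on[OF lin_br lin_r y[unfolded part] basis[OF p r]]] .
  moreover have "bracket q (bG s) ` witt_even \<subseteq> witt_odd"
    unfolding witt_even_def witt_odd_def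
    by (rule linear_span_image_subset[OF lin]) (auto simp: adL W.span_scale W.span_base)
  moreover have "bracket q (bG s) ` witt_odd \<subseteq> witt_even"
    unfolding witt_even_def witt_odd_def
    by (rule linear_span_image_subset[OF lin]) (auto simp: bracket_bG_bG W.span_zero)
  moreover have "bracket q (bG s) ` witt_deg n \<subseteq> witt_deg (n + s)" for n
    unfolding witt_deg_def
    by (rule linear_span_image_subset[OF lin])
      (auto simp: adL bracket_bG_bG W.span_scale W.span_zero W.span_base)
  ultimately show ?thesis
    using lin unfolding odd_q_derivation_def ad_def t_def by blast
qed

section \<open>Degree components and the direct sum\<close>

lemma odd_q_derivations_eq_span:
  assumes q: "q \<noteq> 0" "q \<noteq> 1" "q \<noteq> -1" and s: "1 + q powi (s + 1) \<noteq> 0"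
  shows "odd_q_derivations q s = E.span {ad q (bG s)}"
proof
  show "odd_q_derivations q s \<subseteq> E.span {ad q (bG s)}"
  proof
    fix \<phi> assume "\<phi> \<in> odd_q_derivations q s"
    then obtain k where "\<phi> = ad q (smul k (bG s))"
      using odd_q_derivation_eq_ad[OF q s] by (auto simp: odd_q_derivations_def)
    then have "\<phi> = fsmul k (ad q (bG s))"
      by (simp add: ad_def fsmul_def bracket_linear_simps)
    then show "\<phi> \<in> E.span {ad q (bG s)}"
      by (auto intro: E.span_scale E.span_base)
  qed
  show "E.span {ad q (bG s)} \<subseteq> odd_q_derivations q s"
    using odd_q_derivation_ad[OF q(1,2) s]
    by (intro E.span_minimal E_subspace_odd_q_derivations) (simp add: odd_q_derivations_def)
qed

text \<open>Innerness of one map concerns the denominator of its own degree; the direct sum involves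
  all degrees at once, so there no denominator may vanish.\<close>

theorem proposition5p7:
  fixes q :: complex
  assumes "q \<noteq> 0" and "q \<noteq> 1" and "q \<noteq> -1"
  shows "(\<forall>s \<phi>. 1 + q powi (s + 1) \<noteq> 0 \<longrightarrow> odd_q_derivation q s \<phi> \<longrightarrow> inner_q_derivation q \<phi>) \<and>
    ((\<forall>s::int. 1 + q powi (s + 1) \<noteq> 0) \<longrightarrow>
      is_direct_sum (Der_odd q) (\<lambda>s. E.span {ad q (bG s)}))"
proof (intro conjI allI impI)
  fix s \<phi>
  assume "1 + q powi (s + 1) \<noteq> 0" "odd_q_derivation q s \<phi>"
  then obtain k where "\<phi> = ad q (smul k (bG s))"
    using odd_q_derivation_eq_ad[OF assms] by blast
  moreover have "smul k (bG s) \<in> witt_odd"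
    using bG_odd by (simp add: witt_odd_def W.span_scale)
  ultimately show "inner_q_derivation q \<phi>"
    unfolding inner_q_derivation_def by blast
next
  assume "\<forall>s::int. 1 + q powi (s + 1) \<noteq> 0"
  \<comment> \<open>Equality of the two families transfers directness from
    \<open>Der_odd_direct_sum\<close>.\<close>
  then have "odd_q_derivations q = (\<lambda>s. E.span {ad q (bG s)})"
    using odd_q_derivations_eq_span[OF assms] by blast
  then show "is_direct_sum (Der_odd q) (\<lambda>s. E.span {ad q (bG s)})"
    using Der_odd_direct_sum[of q] by simp
qed

end
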